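(* Let $f$ satisfy (f1) and suppose $f_0=0$ and $f_\infty=+\infty$. Then for every $\lambda\in(0,+\infty)$, problem (MO) has two solutions $u^+$ and $u^-$ such that $u^+$ is positive and strictly concave in $(0,1)$ and $u^-$ is negative and strictly convex in $(0,1)$.
   Context: Let $N\ge 1$ be an integer and $f:\mathbb{R}\to\mathbb{R}$ continuous. For $\lambda\ge 0$, problem (MO) is: find $u\in C^2[0,1]$ with $\left((u'(r))^N\right)'=\lambda^N N r^{N-1} f(-u(r))$ for $0<r<1$ and $u'(0)=u(1)=0$. Condition (f1): $f\in C(\mathbb{R},\mathbb{R})$ and $f(s)s^N>0$ for all $s\neq0$. The quantities $f_0,f_\infty\in[0,+\infty]$ are defined by $f_0^N=\lim_{s\to0} f(s)/s^N$ and $f_\infty^N=\lim_{|s|\to+\infty} f(s)/s^N$ (limits assumed to exist in $[0,+\infty]$). *)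

theory Defs
  imports "HOL-Analysis.Analysis"
begin

definition cond_f1 :: "nat \<Rightarrow> (real \<Rightarrow> real) \<Rightarrow> bool" where
  "cond_f1 N f \<longleftrightarrow> continuous_on UNIV f \<and> (\<forall>s. s \<noteq> 0 \<longrightarrow> f s * s ^ N > 0)"

definition MO_solution :: "nat \<Rightarrow> (real \<Rightarrow> real) \<Rightarrow> real \<Rightarrow> (real \<Rightarrow> real) \<Rightarrow> bool" where
  "MO_solution N f lam u \<longleftrightarrow>
     (\<exists>u' u''.
        (\<forall>r\<in>{0..1}. (u has_real_derivative u' r) (at r within {0..1})) \<and>
        (\<forall>r\<in>{0..1}. (u' has_real_derivative u'' r) (at r within {0..1})) \<and>
        continuous_on {0..1} u'' \<and>
        (\<forall>r\<in>{0<..<1}. ((\<lambda>s. (u' s) ^ N) has_real_derivative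
              lam ^ N * real N * r ^ (N - 1) * f (- u r)) (at r)) \<and>
        u' 0 = 0 \<and> u 1 = 0)"

definition strictly_convex_on :: "real set \<Rightarrow> (real \<Rightarrow> real) \<Rightarrow> bool" where
  "strictly_convex_on S g \<longleftrightarrow>
     (\<forall>x\<in>S. \<forall>y\<in>S. \<forall>t. x \<noteq> y \<and> 0 < t \<and> t < 1 \<longrightarrow>
        g ((1 - t) * x + t * y) < (1 - t) * g x + t * g y)"

definition strictly_concave_on :: "real set \<Rightarrow> (real \<Rightarrow> real) \<Rightarrow> bool" where
  "strictly_concave_on S g \<longleftrightarrow> strictly_convex_on S (\<lambda>x. - g x)"

end

theory Submission
  imports Defs "HOL-Complex_Analysis.Great_Picard"
begin

text \<open>
  Both solutions come from one positive decreasing profile $v$ with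
  $((-v')^N)' = N r^{N-1} h(v)$, $v'(0) = v(1) = 0$: take $u^- = -v$ with $h = \lambda^N f$, and
  $u^+ = v$ with $h(s) = \lambda^N (-1)^N f(-s)$.
  The profile is found by shooting in $\alpha = v(0)$. As $f$ is merely continuous, the initial value
  problem may have several solutions, so the nonlinearity is first evaluated at a delayed argument
  (Tonelli's scheme): the delayed solution is unique and continuous in $\alpha$.
  It is concave, so if it stays nonnegative it lies above the chord $(1 - r)\alpha$; hence superlinearity
  makes $v(1) \le 0$ for large $\alpha$, while $v(1) \ge 0$ for small $\alpha$, uniformly in the delay.
  The intermediate value theorem gives $v(1) = 0$ for some $\alpha$ in a fixed compact interval,
  and Arzela-Ascoli removes the delay.
\<close>

section \<open>Calculus preliminaries: weighted integrals and strict convexity\<close>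

lemma integral_rescale_unit:
  fixes \<phi> :: "real \<Rightarrow> real"
  assumes "0 \<le> r"
  shows "r * integral {0..1} (\<lambda>x. \<phi> (r * x)) = integral {0..r} \<phi>"
proof (cases "r = 0")
  case False
  then have "(\<lambda>x. x / r) ` {0..r} = {0..1}"
    using assms by (auto simp: image_iff divide_simps intro!: bexI[of _ "_ * r"])
  with integral_stretch_real[OF False, of 0 r \<phi>] False assms show ?thesis
    by simp
qed simp

text \<open>The weight is a probability density, so integrating against it is averaging and
  preserves pointwise bounds.\<close>

lemma integral_power_weight_unit:
  assumes "1 \<le> N"
  shows "((\<lambda>x. real N * x ^ (N - 1)) has_integral 1) {0..1::real}"
proof -
  have "((\<lambda>x. real N * x ^ (N - 1)) has_integral (1 ^ N - 0 ^ N)) {0..1::real}"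
    by (rule fundamental_theorem_of_calculus)
       (auto intro!: derivative_eq_intros simp flip: has_real_derivative_iff_has_vector_derivative)
  then show ?thesis
    using assms by (simp add: power_0_left)
qed

text \<open>The mean value theorem on either side of the convex combination turns the increasing
  derivative into increasing chord slopes.\<close>

lemma strictly_convex_on_if_deriv_strict_mono:
  assumes "convex S"
    and der: "\<And>x. x \<in> S \<Longrightarrow> (g has_real_derivative g' x) (at x)"
    and mono: "\<And>x y. x \<in> S \<Longrightarrow> y \<in> S \<Longrightarrow> x < y \<Longrightarrow> g' x < g' y"
  shows "strictly_convex_on S g"
proof -
  have less: "g ((1 - t) * x + t * y) < (1 - t) * g x + t * g y"
    if xy: "x \<in> S" "y \<in> S" "x < y" and t: "0 < t" "t < 1" for x y t
  proof -
    define z where "z = (1 - t) * x + t * y"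
    have zx: "z - x = t * (y - x)" and yz: "y - z = (1 - t) * (y - x)"
      by (simp_all add: z_def algebra_simps)
    then have "x < z" "z < y"
      using xy t by (metis diff_gt_0_iff_gt mult_pos_pos)+
    have "{x..y} \<subseteq> S"
      using \<open>convex S\<close> xy
      by (metis closed_segment_eq_real_ivl closed_segment_subset less_imp_le)
    obtain p where p: "x < p" "p < z" "g z - g x = (z - x) * g' p"
      using MVT2[OF \<open>x < z\<close>, of g g'] der \<open>{x..y} \<subseteq> S\<close> \<open>z < y\<close> by (auto simp: subset_iff)
    obtain q where q: "z < q" "q < y" "g y - g z = (y - z) * g' q"
      using MVT2[OF \<open>z < y\<close>, of g g'] der \<open>{x..y} \<subseteq> S\<close> \<open>x < z\<close> by (auto simp: subset_iff)
    have "g' p < g' q"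
      using mono p q \<open>{x..y} \<subseteq> S\<close> by (auto simp: subset_iff)
    \<comment> \<open>The weight \<open>t * (1 - t) * (y - x)\<close> clears the denominators of
      both chord slopes at once.\<close>
    then have "t * (1 - t) * (y - x) * g' p < t * (1 - t) * (y - x) * g' q"
      using t xy by simp
    moreover have "t * (1 - t) * (y - x) * g' p = (1 - t) * (g z - g x)"
      using p zx by simp
    moreover have "t * (1 - t) * (y - x) * g' q = t * (g y - g z)"
      using q yz by simp
    ultimately have "(1 - t) * (g z - g x) < t * (g y - g z)" by simp
    then show ?thesis
      unfolding z_def[symmetric] by (simp add: algebra_simps)
  qed
  show ?thesis
    unfolding strictly_convex_on_def
  proof (intro ballI allI impI)
    fix x y t :: real
    assume xy: "x \<in> S" "y \<in> S" and t: "x \<noteq> y \<and> 0 < t \<and> t < 1"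
    show "g ((1 - t) * x + t * y) < (1 - t) * g x + t * g y"
    proof (cases "x < y")
      case True
      then show ?thesis using less xy t by blast
    next
      case False
      then show ?thesis using less[of y x "1 - t"] xy t by (simp add: add.commute)
    qed
  qed
qed

section \<open>The integral operator behind the radial equation\<close>

locale radial_source =
  fixes N :: nat and h :: "real \<Rightarrow> real"
  assumes N_pos: "1 \<le> N"
    and h_cont: "continuous_on UNIV h"
    and h_nonneg: "0 \<le> h s"
begin

text \<open>
  Rescaling to the unit interval, $t^N$ times the mean is $\int_0^t N s^{N-1} h(w(s))\,ds$. Unlike
  that integral, the mean stays positive at $t = 0$, which gives $C^2$ regularity at the origin.
\<close>

definition mean :: "(real \<Rightarrow> real) \<Rightarrow> real \<Rightarrow> real" where
  "mean w t = integral {0..1} (\<lambda>x. real N * x ^ (N - 1) * h (w (t * x)))"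

text \<open>The candidate for -v'. Taking t out of the N-th root of \<open>t ^ N * mean w t\<close>
  leaves a root that need not vanish at the origin.\<close>

definition slope :: "(real \<Rightarrow> real) \<Rightarrow> real \<Rightarrow> real" where
  "slope w t = t * root N (mean w t)"

text \<open>This is \<alpha> minus the integral of \<open>slope w\<close> over [0, r], written over
  a fixed interval so that theorems on parameters and limits under the integral apply. A continuous
  fixed point solves the initial value problem with v(0) = \<alpha> and v'(0) = 0.\<close>

definition shoot :: "real \<Rightarrow> (real \<Rightarrow> real) \<Rightarrow> real \<Rightarrow> real" where
  "shoot \<alpha> w r = \<alpha> - r * integral {0..1} (\<lambda>x. slope w (r * x))"

lemma mean_cong: "(\<And>s. s \<in> {0..t} \<Longrightarrow> w s = w' s) \<Longrightarrow> 0 \<le> t \<Longrightarrow> mean w t = mean w' t"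
  unfolding mean_def by (intro integral_cong) (simp add: mult_left_le)

text \<open>Causality: the means that enter are taken at radii \<open>r * x\<close> with x at most 1
  and never look beyond r. This lets the delayed equation be solved interval by interval.\<close>

lemma shoot_cong:
  assumes "\<And>s. s \<in> {0..r} \<Longrightarrow> w s = w' s" and "0 \<le> r"
  shows "shoot \<alpha> w r = shoot \<alpha> w' r"
proof -
  have "slope w (r * x) = slope w' (r * x)" if "x \<in> {0..1}" for x
  proof -
    have "r * x \<le> r" using that assms(2) by (simp add: mult_left_le)
    then have "mean w (r * x) = mean w' (r * x)"
      using that assms by (intro mean_cong) auto
    then show ?thesis by (simp add: slope_def)
  qed
  then have "integral {0..1} (\<lambda>x. slope w (r * x)) = integral {0..1} (\<lambda>x. slope w' (r * x))"
    by (rule integral_cong)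
  then show ?thesis
    by (simp add: shoot_def)
qed

section \<open>Joint continuity in the parameter and the radius\<close>

lemma continuous_on_unit_scaled:
  fixes w :: "'x::topological_space \<Rightarrow> real \<Rightarrow> real"
  assumes "continuous_on (U \<times> {0..1}) (\<lambda>(x, t). w x t)"
  shows "continuous_on ((U \<times> {0..1}) \<times> {0..1}) (\<lambda>(p, s). w (fst p) (snd p * s))"
proof -
  have "continuous_on ((U \<times> {0..1}) \<times> {0..1::real})
    ((\<lambda>(x, t). w x t) \<circ> (\<lambda>p. (fst (fst p), snd (fst p) * snd p)))"
    by (intro continuous_on_compose continuous_intros continuous_on_subset[OF assms])
       (auto simp: mult_le_one)
  then show ?thesis
    by (simp add: o_def split_beta)
qed

lemma continuous_on_h: "continuous_on S g \<Longrightarrow> continuous_on S (\<lambda>x. h (g x))"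
  by (rule continuous_on_compose2[OF h_cont]) auto

lemma continuous_on_mean:
  fixes w :: "'x::topological_space \<Rightarrow> real \<Rightarrow> real"
  assumes "continuous_on (U \<times> {0..1}) (\<lambda>(x, t). w x t)"
  shows "continuous_on (U \<times> {0..1}) (\<lambda>(x, t). mean (w x) t)"
proof -
  have "continuous_on ((U \<times> {0..1}) \<times> {0..1})
    (\<lambda>(p, x). real N * x ^ (N - 1) * h (w (fst p) (snd p * x)))"
    using continuous_on_unit_scaled[OF assms] unfolding split_beta
    by (intro continuous_intros continuous_on_h)
  then show ?thesis
    using integral_continuous_on_param[of "U \<times> {0..1}" 0 1
        "\<lambda>p x. real N * x ^ (N - 1) * h (w (fst p) (snd p * x))"]
    by (simp add: mean_def split_beta)
qed

lemma continuous_on_slope: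
  fixes w :: "'x::topological_space \<Rightarrow> real \<Rightarrow> real"
  assumes "continuous_on (U \<times> {0..1}) (\<lambda>(x, t). w x t)"
  shows "continuous_on (U \<times> {0..1}) (\<lambda>(x, t). slope (w x) t)"
  using continuous_on_mean[OF assms] unfolding slope_def split_beta
  by (intro continuous_intros)

lemma continuous_on_shoot:
  fixes w :: "real \<Rightarrow> real \<Rightarrow> real"
  assumes "continuous_on (U \<times> {0..1}) (\<lambda>(x, t). w x t)"
  shows "continuous_on (U \<times> {0..1}) (\<lambda>(x, t). shoot x (w x) t)"
proof -
  have "continuous_on (U \<times> {0..1}) (\<lambda>p. integral {0..1} (\<lambda>x. slope (w (fst p)) (snd p * x)))"
    using integral_continuous_on_param[of "U \<times> {0..1}" 0 1
        "\<lambda>p x. slope (w (fst p)) (snd p * x)"]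
      continuous_on_unit_scaled[OF continuous_on_slope[OF assms]]
    by simp
  then show ?thesis
    unfolding shoot_def split_beta by (intro continuous_intros)
qed

section \<open>Bounds, monotonicity and concavity for a fixed argument\<close>

context
  fixes w :: "real \<Rightarrow> real"
  assumes w_cont: "continuous_on {0..1} w"
begin

text \<open>A dummy real parameter makes a single function an instance of the parametric continuity
  lemmas.\<close>

lemma w_cont_param: "continuous_on (UNIV \<times> {0..1}) (\<lambda>(x::real, t). w t)"
  unfolding split_beta by (rule continuous_on_compose2[OF w_cont]) (auto intro!: continuous_intros)

lemma continuous_on_mean1: "continuous_on {0..1} (mean w)"
proof -
  have "continuous_on {0..1} ((\<lambda>(x::real, t). mean w t) \<circ> Pair 0)"
    by (intro continuous_on_compose continuous_on_subset[OF continuous_on_mean[OF w_cont_param]]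
        continuous_intros) auto
  then show ?thesis by (simp add: o_def)
qed

lemma continuous_on_slope1: "continuous_on {0..1} (slope w)"
  using continuous_on_mean1 unfolding slope_def by (intro continuous_intros)

lemma mean_integrand_cont:
  assumes "t \<in> {0..1}"
  shows "continuous_on {0..1} (\<lambda>x. real N * x ^ (N - 1) * h (w (t * x)))"
  using assms
  by (intro continuous_intros continuous_on_h continuous_on_compose2[OF w_cont]) (auto simp: mult_le_one)

lemma slope_integrable:
  assumes "t \<in> {0..1}"
  shows "(\<lambda>x. slope w (t * x)) integrable_on {0..1}"
  using assms
  by (intro integrable_continuous_real continuous_on_compose2[OF continuous_on_slope1] continuous_intros)
     (auto simp: mult_le_one)

lemma mean_le:
  assumes t: "t \<in> {0..1}" and M: "\<And>s. s \<in> {0..t} \<Longrightarrow> h (w s) \<le> M"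
  shows "mean w t \<le> M"
proof -
  have "mean w t \<le> integral {0..1} (\<lambda>x. real N * x ^ (N - 1) * M)"
    unfolding mean_def
  proof (rule integral_le)
    show "real N * x ^ (N - 1) * h (w (t * x)) \<le> real N * x ^ (N - 1) * M"
      if "x \<in> {0..1}" for x
      using that t by (intro mult_left_mono M) (auto simp: mult_left_le)
  qed (intro integrable_continuous_real mean_integrand_cont continuous_intros t)+
  also have "\<dots> = M"
    using integral_unique[OF has_integral_mult_left[OF integral_power_weight_unit[OF N_pos], of M]]
    by (simp only: mult_1)
  finally show ?thesis .
qed

lemma mean_ge:
  assumes t: "t \<in> {0..1}" and M: "\<And>s. s \<in> {0..t} \<Longrightarrow> M \<le> h (w s)"
  shows "M \<le> mean w t"
proof -
  have "M = integral {0..1} (\<lambda>x. real N * x ^ (N - 1) * M)"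
    using integral_unique[OF has_integral_mult_left[OF integral_power_weight_unit[OF N_pos], of M]]
    by (simp only: mult_1)
  also have "\<dots> \<le> mean w t"
    unfolding mean_def
  proof (rule integral_le)
    show "real N * x ^ (N - 1) * M \<le> real N * x ^ (N - 1) * h (w (t * x))"
      if "x \<in> {0..1}" for x
      using that t by (intro mult_left_mono M) (auto simp: mult_left_le)
  qed (intro integrable_continuous_real mean_integrand_cont continuous_intros t)+
  finally show ?thesis .
qed

lemma mean_nonneg: "t \<in> {0..1} \<Longrightarrow> 0 \<le> mean w t"
  using mean_ge h_nonneg by blast

lemma slope_nonneg: "t \<in> {0..1} \<Longrightarrow> 0 \<le> slope w t"
  using mean_nonneg N_pos by (simp add: slope_def)

text \<open>The integrated differential equation. The root cancels as the mean is nonnegative; of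
  the N factors t, one serves the substitution s = t x and the others move into the weight.\<close>

lemma slope_power: "t \<in> {0..1} \<Longrightarrow> slope w t ^ N = integral {0..t} (\<lambda>s. real N * s ^ (N - 1) * h (w s))"
proof -
  assume t: "t \<in> {0..1}"
  have "slope w t ^ N = t ^ N * mean w t"
    using mean_nonneg[OF t] N_pos by (simp add: slope_def power_mult_distrib)
  also have "\<dots> = t * (t ^ (N - 1) * mean w t)"
    using N_pos power_minus_mult[of N t] by (simp add: mult_ac)
  also have "\<dots> = t * integral {0..1} (\<lambda>x. t ^ (N - 1) * (real N * x ^ (N - 1) * h (w (t * x))))"
    unfolding mean_def by (subst integral_mult_right) (rule refl)
  also have "\<dots> = t * integral {0..1} (\<lambda>x. (\<lambda>s. real N * s ^ (N - 1) * h (w s)) (t * x))"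
    by (simp add: power_mult_distrib mult_ac)
  also have "\<dots> = integral {0..t} (\<lambda>s. real N * s ^ (N - 1) * h (w s))"
    using t by (subst integral_rescale_unit) auto
  finally show ?thesis .
qed

lemma rate_cont: "continuous_on {0..1} (\<lambda>s. real N * s ^ (N - 1) * h (w s))"
  by (intro continuous_intros continuous_on_h w_cont)

text \<open>The N-th powers integrate a nonnegative rate over growing intervals. Consequently
  \<open>shoot \<alpha> w\<close> is concave on the unit interval.\<close>

lemma slope_mono:
  assumes "0 \<le> s" "s \<le> t" "t \<le> 1"
  shows "slope w s \<le> slope w t"
proof -
  have "(\<lambda>s. real N * s ^ (N - 1) * h (w s)) integrable_on {0..q}" if "q \<le> 1" for q
    by (rule integrable_continuous_real, rule continuous_on_subset[OF rate_cont]) (use that in auto)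
  then have "slope w s ^ N \<le> slope w t ^ N"
    using assms h_nonneg by (subst (1 2) slope_power) (auto intro!: integral_subset_le)
  then show ?thesis
    using N_pos slope_nonneg assms by (simp add: power_mono_iff)
qed

lemma shoot_eq_integral: "0 \<le> r \<Longrightarrow> shoot \<alpha> w r = \<alpha> - integral {0..r} (slope w)"
  by (simp add: shoot_def integral_rescale_unit)

lemma shoot_le: "r \<in> {0..1} \<Longrightarrow> shoot \<alpha> w r \<le> \<alpha>"
  using slope_nonneg
  by (auto simp: shoot_def mult_le_one intro!: mult_nonneg_nonneg integral_nonneg slope_integrable)

text \<open>As the slope increases, its average over [0, r] is at most its average over [0, 1], and
  the latter is at most \<alpha> when the end value is nonnegative.\<close>

lemma shoot_ge_chord:
  assumes r: "r \<in> {0..1}" and "0 \<le> shoot \<alpha> w 1"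
  shows "(1 - r) * \<alpha> \<le> shoot \<alpha> w r"
proof -
  have "integral {0..1} (\<lambda>x. slope w (r * x)) \<le> integral {0..1} (\<lambda>x. slope w (1 * x))"
    using r by (intro integral_le slope_integrable slope_mono) (auto simp: mult_left_le_one_le)
  also have "\<dots> \<le> \<alpha>"
    using assms by (simp add: shoot_def)
  finally have "r * integral {0..1} (\<lambda>x. slope w (r * x)) \<le> r * \<alpha>"
    using r by (simp add: mult_left_mono)
  then show ?thesis
    by (simp add: shoot_def algebra_simps)
qed

lemma slope_le:
  assumes "t \<in> {0..1}" "0 \<le> L" "\<And>s. s \<in> {0..1} \<Longrightarrow> h (w s) \<le> L ^ N"
  shows "slope w t \<le> L"
proof -
  have "root N (mean w t) \<le> root N (L ^ N)"
    using mean_le[of t "L ^ N"] assms N_pos by (simp add: Suc_le_eq)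
  then have "root N (mean w t) \<le> L"
    using assms N_pos by (simp add: real_root_power_cancel)
  then have "t * root N (mean w t) \<le> 1 * L"
    using assms mean_nonneg[of t] N_pos by (intro mult_mono) auto
  then show ?thesis by (simp add: slope_def)
qed

text \<open>The slope lies between 0 and L. The constant L depends on neither \<alpha> nor the shape
  of w, which later yields equicontinuity.\<close>

lemma shoot_lipschitz:
  assumes L: "0 \<le> L" "\<And>s. s \<in> {0..1} \<Longrightarrow> h (w s) \<le> L ^ N"
    and "r \<in> {0..1}" "r' \<in> {0..1}"
  shows "\<bar>shoot \<alpha> w r - shoot \<alpha> w r'\<bar> \<le> L * \<bar>r - r'\<bar>"
proof -
  have le: "\<bar>shoot \<alpha> w r - shoot \<alpha> w r'\<bar> \<le> L * \<bar>r - r'\<bar>" if "0 \<le> r" "r \<le> r'" "r' \<le> 1" for r r' :: real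
  proof -
    have int: "slope w integrable_on {p..q}" if "0 \<le> p" "q \<le> 1" for p q
      using that by (intro integrable_continuous_real continuous_on_subset[OF continuous_on_slope1]) auto
    have "shoot \<alpha> w r - shoot \<alpha> w r' = integral {r..r'} (slope w)"
      using Henstock_Kurzweil_Integration.integral_combine[of 0 r r' "slope w"] that int[of 0 r']
      by (simp add: shoot_eq_integral)
    moreover have "0 \<le> integral {r..r'} (slope w)"
      using that by (intro integral_nonneg int slope_nonneg) auto
    moreover have "integral {r..r'} (slope w) \<le> integral {r..r'} (\<lambda>_. L)"
      using that L by (intro integral_le int slope_le) auto
    ultimately show ?thesis
      using that by (simp add: mult.commute)
  qed
  show ?thesis
    using le[of r r'] le[of r' r] assms by (cases "r \<le> r'") (auto simp: abs_minus_commute)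
qed

end

section \<open>Limits along pointwise convergent sequences\<close>

lemma mean_tendsto:
  assumes cont: "\<And>n. continuous_on {0..1} (W n)"
    and bound: "\<And>n s. s \<in> {0..1} \<Longrightarrow> h (W n s) \<le> M"
    and lim: "\<And>s. s \<in> {0..1} \<Longrightarrow> (\<lambda>n. W n s) \<longlonglongrightarrow> w s"
    and t: "t \<in> {0..1}"
  shows "(\<lambda>n. mean (W n) t) \<longlonglongrightarrow> mean w t"
  unfolding mean_def
proof (rule dominated_convergence(2))
  show "(\<lambda>x. real N * x ^ (N - 1) * h (W n (t * x))) integrable_on {0..1}" for n
    by (intro integrable_continuous_real mean_integrand_cont cont t)
  show "(\<lambda>x. real N * x ^ (N - 1) * M) integrable_on {0..1}"
    by (intro integrable_continuous_real continuous_intros)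
  fix x :: real assume x: "x \<in> {0..1}"
  then have tx: "t * x \<in> {0..1}"
    using t by (auto simp: mult_le_one)
  show "norm (real N * x ^ (N - 1) * h (W n (t * x))) \<le> real N * x ^ (N - 1) * M" for n
    using x bound[OF tx] h_nonneg by (simp add: abs_mult mult_left_mono)
  show "(\<lambda>n. real N * x ^ (N - 1) * h (W n (t * x))) \<longlonglongrightarrow> real N * x ^ (N - 1) * h (w (t * x))"
    by (intro tendsto_intros continuous_on_tendsto_compose[OF h_cont] lim tx) auto
qed

text \<open>Dominated convergence a second time: the slopes converge pointwise by
  \<open>mean_tendsto\<close> and are dominated by the constant L.\<close>

lemma shoot_tendsto:
  assumes cont: "\<And>n. continuous_on {0..1} (W n)"
    and L: "0 \<le> L"
    and bound: "\<And>n s. s \<in> {0..1} \<Longrightarrow> h (W n s) \<le> L ^ N"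
    and lim: "\<And>s. s \<in> {0..1} \<Longrightarrow> (\<lambda>n. W n s) \<longlonglongrightarrow> w s"
    and "\<alpha> \<longlonglongrightarrow> \<alpha>'" and r: "r \<in> {0..1}"
  shows "(\<lambda>n. shoot (\<alpha> n) (W n) r) \<longlonglongrightarrow> shoot \<alpha>' w r"
proof -
  have "(\<lambda>n. integral {0..1} (\<lambda>x. slope (W n) (r * x))) \<longlonglongrightarrow> integral {0..1} (\<lambda>x. slope w (r * x))"
  proof (rule dominated_convergence(2))
    show "(\<lambda>x. slope (W n) (r * x)) integrable_on {0..1}" for n
      by (rule slope_integrable[OF cont r])
    show "(\<lambda>_. L) integrable_on {0..1::real}"
      by (intro integrable_continuous_real continuous_intros)
    fix x :: real assume "x \<in> {0..1}"
    then have rx: "r * x \<in> {0..1}"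
      using r by (auto simp: mult_le_one)
    show "norm (slope (W n) (r * x)) \<le> L" for n
      using slope_nonneg[OF cont rx, of n] slope_le[OF cont rx L bound] by simp
    show "(\<lambda>n. slope (W n) (r * x)) \<longlonglongrightarrow> slope w (r * x)"
      unfolding slope_def by (intro tendsto_intros mean_tendsto[OF cont bound lim rx])
  qed
  then show ?thesis
    unfolding shoot_def by (intro tendsto_intros assms)
qed

section \<open>Differentiability of \<open>slope\<close> and \<open>shoot\<close>\<close>

lemma slope_power_has_derivative:
  assumes w: "continuous_on {0..1} w" and r: "r \<in> {0..1}"
  shows "((\<lambda>s. slope w s ^ N) has_real_derivative real N * r ^ (N - 1) * h (w r)) (at r within {0..1})"
  using integral_has_real_derivative[OF rate_cont[OF w] r]
  by (rule has_field_derivative_transform_within[where d = 1]) (use r slope_power[OF w] in auto)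

text \<open>Away from the origin the chain rule for the N-th root applies to
  \<open>slope_power_has_derivative\<close>. At the origin \<open>slope w r ^ N\<close> is 0, where
  the root is not differentiable for N > 1, so the difference quotient is treated directly.\<close>

lemma slope_has_derivative:
  assumes w: "continuous_on {0..1} w" and r: "r \<in> {0..1}" and pos: "0 < mean w r"
  shows "(slope w has_real_derivative h (w r) / root N (mean w r) ^ (N - 1)) (at r within {0..1})"
proof (cases "r = 0")
  case True
  have mean0: "mean w 0 = h (w 0)"
    using mean_le[OF w, of 0 "h (w 0)"] mean_ge[OF w, of 0 "h (w 0)"] by auto
  then have "root N (mean w 0) ^ N = h (w 0)"
    using pos True N_pos by simp
  \<comment> \<open>At the origin the mean is just \<open>h (w 0)\<close>, so the general formula
    collapses to the root itself.\<close>
  then have D: "h (w r) / root N (mean w r) ^ (N - 1) = root N (mean w 0)"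
    using pos True N_pos power_minus_mult[of N "root N (mean w 0)"]
    by (simp add: divide_eq_eq mult.commute)
  have "((\<lambda>t. root N (mean w t)) \<longlongrightarrow> root N (mean w 0)) (at 0 within {0..1})"
    using continuous_on_mean1[OF w] by (intro tendsto_intros) (simp add: continuous_on_def)
  \<comment> \<open>The explicit factor t in \<open>slope\<close> cancels in the difference
    quotient.\<close>
  moreover have "\<forall>\<^sub>F t in at 0 within {0..1}. root N (mean w t) = (slope w t - slope w 0) / (t - 0)"
    by (auto simp: eventually_at_filter slope_def)
  ultimately show ?thesis
    unfolding has_field_derivative_iff D using True by (auto elim: Lim_transform_eventually)
next
  case False
  then have "0 < slope w r"
    using r pos N_pos by (simp add: slope_def)
  then have root: "root N (slope w r ^ N) = slope w r"
    using N_pos by (simp add: real_root_power_cancel)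
  have "((\<lambda>t. root N (slope w t ^ N)) has_real_derivative
      inverse (real N * root N (slope w r ^ N) ^ (N - Suc 0)) * (real N * r ^ (N - 1) * h (w r)))
      (at r within {0..1})"
    using \<open>0 < slope w r\<close> N_pos
    by (intro DERIV_chain2[OF DERIV_real_root] slope_power_has_derivative[OF w r]) auto
  \<comment> \<open>The power \<open>r ^ (N - 1)\<close> cancels against the same power inside the
    slope, leaving an expression without singularity at the origin.\<close>
  moreover have "inverse (real N * root N (slope w r ^ N) ^ (N - Suc 0)) * (real N * r ^ (N - 1) * h (w r))
      = h (w r) / root N (mean w r) ^ (N - 1)"
    unfolding root using N_pos False pos by (simp add: slope_def power_mult_distrib field_simps)
  ultimately have "((\<lambda>t. root N (slope w t ^ N)) has_real_derivative
      h (w r) / root N (mean w r) ^ (N - 1)) (at r within {0..1})" by simp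
  then show ?thesis
    by (rule has_field_derivative_transform_within[where d = 1])
       (use r N_pos slope_nonneg[OF w] in \<open>auto simp: real_root_power_cancel\<close>)
qed

lemma shoot_has_derivative:
  assumes w: "continuous_on {0..1} w" and r: "r \<in> {0..1}"
  shows "(shoot \<alpha> w has_real_derivative - slope w r) (at r within {0..1})"
proof -
  have "((\<lambda>r. \<alpha> - integral {0..r} (slope w)) has_real_derivative - slope w r) (at r within {0..1})"
    using integral_has_real_derivative[OF continuous_on_slope1[OF w] r]
    by (auto intro!: derivative_eq_intros)
  then show ?thesis
    by (rule has_field_derivative_transform_within[where d = 1]) (use r shoot_eq_integral[OF w] in auto)
qed

end

section \<open>Small and large starting values, uniformly in the delay\<close>

locale radial_shooting = radial_source +
  fixes a b :: real
  assumes a_pos: "0 < a" and a_le_b: "a \<le> b"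
    and h_pos: "0 < s \<Longrightarrow> 0 < h s"
    and h_small: "s \<le> a \<Longrightarrow> h s \<le> a ^ N"
    and h_large: "b / 2 \<le> s \<Longrightarrow> (8 * b) ^ N \<le> h s"
begin

context
  fixes v \<delta> :: "real \<Rightarrow> real" and \<alpha> :: real
  assumes v: "continuous_on {0..1} v" and \<delta>: "continuous_on {0..1} \<delta>"
    and \<delta>_nonneg: "\<And>s. s \<in> {0..1} \<Longrightarrow> 0 \<le> \<delta> s" and \<delta>_le: "\<And>s. s \<in> {0..1} \<Longrightarrow> \<delta> s \<le> s"
    and fixpoint: "\<And>r. r \<in> {0..1} \<Longrightarrow> v r = shoot \<alpha> (\<lambda>s. v (\<delta> s)) r"
begin

lemma delayed_mem: "s \<in> {0..1} \<Longrightarrow> \<delta> s \<in> {0..1}"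
  using \<delta>_nonneg[of s] \<delta>_le[of s] by simp

lemma delayed_continuous: "continuous_on {0..1} (\<lambda>s. v (\<delta> s))"
  by (rule continuous_on_compose2[OF v \<delta>]) (use delayed_mem in auto)

lemma delayed_upper: "r \<in> {0..1} \<Longrightarrow> v r \<le> \<alpha>"
  using fixpoint shoot_le[OF delayed_continuous] by simp

lemma delayed_lower: "r \<in> {0..1} \<Longrightarrow> 0 \<le> v 1 \<Longrightarrow> (1 - r) * \<alpha> \<le> v r"
  using fixpoint shoot_ge_chord[OF delayed_continuous, of r \<alpha>] by simp

text \<open>All arguments of h stay below a, whatever their sign, so h is at most
  \<open>a ^ N\<close> and the slope at most a. Over unit length the solution loses no more than its
  starting value.\<close>

lemma small_start_stays_nonneg:
  assumes "\<alpha> = a"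
  shows "0 \<le> v 1"
proof -
  have "slope (\<lambda>s. v (\<delta> s)) t \<le> a" if "t \<in> {0..1}" for t
    using that a_pos delayed_upper delayed_mem assms
    by (intro slope_le[OF delayed_continuous] h_small) auto
  then have "integral {0..1} (slope (\<lambda>s. v (\<delta> s))) \<le> integral {0..1} (\<lambda>_::real. a)"
    using integrable_continuous_real[OF continuous_on_slope1[OF delayed_continuous]]
    by (intro integral_le) auto
  then show ?thesis
    using fixpoint[of 1] assms by (simp add: shoot_eq_integral[OF delayed_continuous])
qed

text \<open>If \<open>v 1\<close> were positive, the chord bound would keep v above b/2 on the first
  half, also at delayed arguments, which only move left. Then h is at least
  \<open>(8 * b) ^ N\<close> and the slope at least 8 b t there, whose integral up to 1/2 is b. So
  v(1/2) is at most 0, against the chord bound b/2.\<close>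

lemma large_start_hits_zero:
  assumes "\<alpha> = b"
  shows "v 1 \<le> 0"
proof (rule ccontr)
  assume "\<not> v 1 \<le> 0"
  have b: "0 < b" using a_pos a_le_b by simp
  have slope: "8 * b * t \<le> slope (\<lambda>s. v (\<delta> s)) t" if t: "t \<in> {0..1/2}" for t
  proof -
    have "(8 * b) ^ N \<le> h (v (\<delta> s))" if s: "s \<in> {0..t}" for s
    proof (rule h_large)
      have "(1 / 2) * b \<le> (1 - \<delta> s) * b"
        using \<delta>_le[of s] s t b by (intro mult_right_mono) auto
      also have "\<dots> \<le> v (\<delta> s)"
        using delayed_lower delayed_mem s t assms \<open>\<not> v 1 \<le> 0\<close> by simp
      finally show "b / 2 \<le> v (\<delta> s)" by simp
    qed
    then have "root N ((8 * b) ^ N) \<le> root N (mean (\<lambda>s. v (\<delta> s)) t)"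
      using t N_pos by (intro real_root_le_mono mean_ge[OF delayed_continuous]) auto
    then have "8 * b \<le> root N (mean (\<lambda>s. v (\<delta> s)) t)"
      using N_pos b by (subst (asm) real_root_power_cancel) auto
    then show ?thesis
      using t by (simp add: slope_def mult_left_mono mult.commute)
  qed
  \<comment> \<open>In the rescaled variable the integral is 2 b; the factor r = 1/2 in
    \<open>shoot\<close> turns it into the loss b.\<close>
  have "2 * b = integral {0..1} (\<lambda>x. 8 * b * (1 / 2 * x))"
    using integral_unique[OF ident_has_integral[of 0 "1::real"]] by simp
  also have "\<dots> \<le> integral {0..1} (\<lambda>x. slope (\<lambda>s. v (\<delta> s)) (1 / 2 * x))"
    by (intro integral_le slope slope_integrable[OF delayed_continuous]
        integrable_continuous_real continuous_intros) auto
  finally have "v (1 / 2) \<le> 0"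
    using fixpoint[of "1 / 2"] assms by (simp add: shoot_def)
  moreover have "1 / 2 * b \<le> v (1 / 2)"
    using delayed_lower[of "1 / 2"] assms \<open>\<not> v 1 \<le> 0\<close> by simp
  ultimately show False using b by simp
qed

end

section \<open>Tonelli's scheme and the delayed boundary value problem\<close>

definition delay :: "nat \<Rightarrow> real \<Rightarrow> real" where
  "delay n s = max 0 (s - 1 / real (Suc n))"

lemma delay_bounds: "0 \<le> delay n s" "0 \<le> s \<Longrightarrow> delay n s \<le> s"
  by (simp_all add: delay_def)

lemma delay_mem: "s \<in> {0..1} \<Longrightarrow> delay n s \<in> {0..1}"
  using delay_bounds[where n = n and s = s] by simp

lemma delay_continuous: "continuous_on S (delay n)"
  unfolding delay_def by (intro continuous_intros)

lemma delay_close: "0 \<le> s \<Longrightarrow> \<bar>delay n s - s\<bar> \<le> 1 / real (Suc n)"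
  by (auto simp: delay_def max_def)

text \<open>
  The $k$-th iterate is already the delayed solution on $[0, k/(n+1)]$, since there it only looks
  back to $[0, (k-1)/(n+1)]$.
\<close>

primrec tonelli :: "nat \<Rightarrow> nat \<Rightarrow> real \<Rightarrow> real \<Rightarrow> real" where
  "tonelli n 0 \<alpha> = (\<lambda>r. \<alpha>)"
| tonelli_Suc: "tonelli n (Suc k) \<alpha> = shoot \<alpha> (\<lambda>s. tonelli n k \<alpha> (delay n s))"

declare tonelli_Suc [simp del]

text \<open>Each iterate is composed of continuous operations. Continuity in the starting value is
  what the intermediate value theorem will use.\<close>

lemma tonelli_continuous: "continuous_on (UNIV \<times> {0..1}) (\<lambda>(\<alpha>, r). tonelli n k \<alpha> r)"
proof (induction k)
  case 0
  show ?case by (simp add: split_beta) (intro continuous_intros)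
next
  case (Suc k)
  have "continuous_on (UNIV \<times> {0..1}) ((\<lambda>(\<alpha>, r). tonelli n k \<alpha> r) \<circ> (\<lambda>p. (fst p, delay n (snd p))))"
    using delay_mem[of _ n]
    by (intro continuous_on_compose continuous_on_subset[OF Suc] continuous_intros
        continuous_on_compose2[OF delay_continuous[of UNIV]]) auto
  then have "continuous_on (UNIV \<times> {0..1}) (\<lambda>(\<alpha>, s). tonelli n k \<alpha> (delay n s))"
    by (simp add: o_def split_beta)
  then show ?case
    using continuous_on_shoot[of UNIV "\<lambda>\<alpha> s. tonelli n k \<alpha> (delay n s)"] by (simp add: tonelli_Suc)
qed

lemma tonelli_stable:
  assumes "0 \<le> r" "r \<le> real k / real (Suc n)"
  shows "tonelli n (Suc k) \<alpha> r = tonelli n k \<alpha> r"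
  using assms
proof (induction k arbitrary: r)
  case 0
  \<comment> \<open>Only r = 0 is left here, where \<open>shoot\<close> returns \<alpha>.\<close>
  then show ?case by (simp add: tonelli_Suc shoot_def)
next
  case (Suc k)
  have "tonelli n (Suc k) \<alpha> (delay n s) = tonelli n k \<alpha> (delay n s)" if "s \<in> {0..r}" for s
  proof (rule Suc.IH[OF delay_bounds(1)])
    have "s - 1 / real (Suc n) \<le> real (Suc k) / real (Suc n) - 1 / real (Suc n)"
      using that Suc.prems by (intro diff_right_mono) auto
    also have "\<dots> = real k / real (Suc n)"
      by (simp flip: diff_divide_distrib)
    finally show "delay n s \<le> real k / real (Suc n)"
      unfolding delay_def by simp
  qed
  then have "shoot \<alpha> (\<lambda>s. tonelli n (Suc k) \<alpha> (delay n s)) r = shoot \<alpha> (\<lambda>s. tonelli n k \<alpha> (delay n s)) r"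
    using Suc.prems by (intro shoot_cong) auto
  then show ?case
    by (simp only: tonelli_Suc)
qed

text \<open>The end value is nonnegative for the start a and nonpositive for the start b, so it
  vanishes in between. That [a, b] is the same for all n keeps the later limit away from the zero
  solution.\<close>

lemma delayed_solution_exists:
  obtains \<alpha> v where "\<alpha> \<in> {a..b}" "continuous_on {0..1} v"
    "\<And>r. r \<in> {0..1} \<Longrightarrow> v r = shoot \<alpha> (\<lambda>s. v (delay n s)) r" "v 1 = 0"
proof -
  \<comment> \<open>With k = n + 1 the iterate is stable up to (n + 1)/(n + 1) = 1, hence on the
    whole interval.\<close>
  let ?v = "tonelli n (Suc n)"
  have fixpoint: "?v \<alpha> r = shoot \<alpha> (\<lambda>s. ?v \<alpha> (delay n s)) r" if "r \<in> {0..1}" for \<alpha> r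
    using tonelli_stable[of r "Suc n" n \<alpha>] that tonelli_Suc[of n "Suc n" \<alpha>] by simp
  have cont: "continuous_on {0..1} (?v \<alpha>)" for \<alpha>
  proof -
    have "continuous_on {0..1} ((\<lambda>(\<alpha>, r). ?v \<alpha> r) \<circ> Pair \<alpha>)"
      by (intro continuous_on_compose continuous_intros continuous_on_subset[OF tonelli_continuous]) auto
    then show ?thesis by (simp add: o_def)
  qed
  have "continuous_on {a..b} ((\<lambda>(\<alpha>, r). ?v \<alpha> r) \<circ> (\<lambda>\<alpha>. (\<alpha>, 1)))"
    by (intro continuous_on_compose continuous_intros continuous_on_subset[OF tonelli_continuous]) auto
  then have "continuous_on {a..b} (\<lambda>\<alpha>. ?v \<alpha> 1)"
    by (simp add: o_def)
  moreover have "0 \<le> ?v a 1"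
    by (rule small_start_stays_nonneg[OF cont delay_continuous _ _ fixpoint])
       (use delay_bounds in auto)
  moreover have "?v b 1 \<le> 0"
    by (rule large_start_hits_zero[OF cont delay_continuous _ _ fixpoint])
       (use delay_bounds in auto)
  ultimately obtain \<alpha> where "a \<le> \<alpha>" "\<alpha> \<le> b" "?v \<alpha> 1 = 0"
    using IVT2'[of "\<lambda>\<alpha>. ?v \<alpha> 1" b 0 a] a_le_b by blast
  then show ?thesis
    using that[of \<alpha> "?v \<alpha>"] cont fixpoint by simp
qed

section \<open>Removing the delay by compactness\<close>

lemma solution_exists:
  obtains \<alpha> v where "0 < \<alpha>" "continuous_on {0..1} v"
    "\<And>r. r \<in> {0..1} \<Longrightarrow> v r = shoot \<alpha> v r" "v 1 = 0"
proof -
  have "\<exists>\<alpha> v. \<alpha> \<in> {a..b} \<and> continuous_on {0..1} v \<and>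
      (\<forall>r\<in>{0..1}. v r = shoot \<alpha> (\<lambda>s. v (delay n s)) r) \<and> v 1 = 0" for n
    by (rule delayed_solution_exists[of n]) blast
  then obtain \<alpha> v where \<alpha>: "\<And>n. \<alpha> n \<in> {a..b}" and cont: "\<And>n. continuous_on {0..1} (v n)"
    and fixpoint: "\<And>n r. r \<in> {0..1} \<Longrightarrow> v n r = shoot (\<alpha> n) (\<lambda>s. v n (delay n s)) r"
    and end0: "\<And>n. v n 1 = 0"
    by metis
  note delayed = cont delay_continuous delay_bounds(1) delay_bounds(2) fixpoint
  \<comment> \<open>Confinement to the compact interval [0, b] bounds h along the sequence
    independently of n.\<close>
  have upper: "v n r \<le> b" and lower: "0 \<le> v n r" if r: "r \<in> {0..1}" for n r
  proof -
    show "v n r \<le> b"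
      using delayed_upper[OF delayed r, of n] \<alpha>[of n] by auto
    have "0 \<le> (1 - r) * \<alpha> n"
      using r \<alpha>[of n] a_pos by auto
    then show "0 \<le> v n r"
      using delayed_lower[OF delayed r, of n] end0[of n] by auto
  qed
  have "bounded (h ` {0..b})"
    by (intro compact_imp_bounded compact_continuous_image continuous_on_subset[OF h_cont]) auto
  then obtain M where M: "\<And>s. s \<in> {0..b} \<Longrightarrow> h s \<le> M"
    unfolding bounded_real by (metis abs_le_D1 imageI)
  \<comment> \<open>Since L is at least 1, M is at most \<open>L ^ N\<close>, the form required by
    \<open>shoot_lipschitz\<close>, and division by L is safe.\<close>
  define L where "L = max 1 M"
  have "M \<le> L ^ N"
    using self_le_power[of L N] N_pos by (auto simp: L_def)
  have L0: "0 \<le> L" by (simp add: L_def)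
  have hL: "h (v n (delay n s)) \<le> L ^ N" if "s \<in> {0..1}" for n s
  proof -
    note mem = delay_mem[OF that, of n]
    have "h (v n (delay n s)) \<le> M"
      using upper[OF mem] lower[OF mem] by (intro M) simp
    with \<open>M \<le> L ^ N\<close> show ?thesis by simp
  qed
  have dcont: "continuous_on {0..1} (\<lambda>s. v n (delay n s))" for n
    by (rule delayed_continuous[OF delayed]) auto
  have lip: "\<bar>v n r - v n r'\<bar> \<le> L * \<bar>r - r'\<bar>" if "r \<in> {0..1}" "r' \<in> {0..1}" for n r r'
    using shoot_lipschitz[OF dcont L0 hL that] fixpoint that by simp
  have bound: "norm (v n x) \<le> b" if "x \<in> {0..1}" for n x
    using upper[OF that] lower[OF that] by simp
  have equicont: "\<exists>d. 0 < d \<and> (\<forall>n y. y \<in> {0..1} \<and> norm (x - y) < d \<longrightarrow> norm (v n x - v n y) < e)"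
    if x: "x \<in> {0..1}" and e: "0 < e" for x e
  proof (intro exI conjI allI impI)
    show "0 < e / L" using e by (simp add: L_def)
    fix n y assume y: "y \<in> {0..1} \<and> norm (x - y) < e / L"
    then have "L * \<bar>x - y\<bar> < e"
      by (simp add: L_def field_simps)
    then show "norm (v n x - v n y) < e"
      using lip[of x y n] x y by simp
  qed
  obtain g k where g: "continuous_on {0..1} g" and k: "strict_mono (k :: nat \<Rightarrow> nat)"
    and lim: "\<And>e. 0 < e \<Longrightarrow> \<exists>m. \<forall>n x. m \<le> n \<and> x \<in> {0..1} \<longrightarrow> norm (v (k n) x - g x) < e"
  proof (rule Arzela_Ascoli[OF compact_Icc bound equicont])
    fix g :: "real \<Rightarrow> real" and k :: "nat \<Rightarrow> nat"
    assume "continuous_on {0..1} g" "strict_mono k"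
      "\<And>e. 0 < e \<Longrightarrow> \<exists>m. \<forall>n x. m \<le> n \<and> x \<in> {0..1} \<longrightarrow> norm (v (k n) x - g x) < e"
    then show thesis by (rule that)
  qed auto
  have tends: "(\<lambda>n. v (k n) r) \<longlonglongrightarrow> g r" if "r \<in> {0..1}" for r
    unfolding LIMSEQ_iff using lim that by blast
  \<comment> \<open>The common Lipschitz constant makes the error from the delay at most L/(k n +
    1), so delayed values have the same limit.\<close>
  have dtends: "(\<lambda>n. v (k n) (delay (k n) s)) \<longlonglongrightarrow> g s" if s: "s \<in> {0..1}" for s
  proof -
    have "(\<lambda>n. L * (1 / real (Suc n))) \<longlonglongrightarrow> L * 0"
      by (intro tendsto_intros LIMSEQ_Suc[OF lim_1_over_n])
    then have null: "((\<lambda>n. L * (1 / real (Suc n))) \<circ> k) \<longlonglongrightarrow> 0"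
      using LIMSEQ_subseq_LIMSEQ[OF _ k] by simp
    have close: "norm (v (k n) (delay (k n) s) - v (k n) s) \<le> ((\<lambda>n. L * (1 / real (Suc n))) \<circ> k) n" for n
    proof -
      have "L * \<bar>delay (k n) s - s\<bar> \<le> L * (1 / real (Suc (k n)))"
        using delay_close[of s "k n"] s L0 by (intro mult_left_mono) auto
      then show ?thesis
        using lip[OF delay_mem[OF s, of "k n"] s, of "k n"] unfolding o_def real_norm_def by linarith
    qed
    have "(\<lambda>n. v (k n) (delay (k n) s) - v (k n) s) \<longlonglongrightarrow> 0"
      by (rule Lim_null_comparison[OF _ null]) (intro always_eventually allI close)
    from tendsto_add[OF this tends[OF s]] show ?thesis by simp
  qed
  \<comment> \<open>The starting values are values at 0, so they converge as well, and their lower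
    bound a passes to the limit.\<close>
  have start: "v n 0 = \<alpha> n" for n
    using fixpoint[of 0 n] by (simp add: shoot_def)
  then have \<alpha>tends: "(\<lambda>n. \<alpha> (k n)) \<longlonglongrightarrow> g 0"
    using tends[of 0] by simp
  then have "a \<le> g 0"
    by (rule LIMSEQ_le_const) (use \<alpha> in auto)
  with a_pos have start_pos: "0 < g 0"
    by simp
  have limit_fixpoint: "g r = shoot (g 0) g r" if r: "r \<in> {0..1}" for r
  proof (rule LIMSEQ_unique[OF tends[OF r]])
    show "(\<lambda>n. v (k n) r) \<longlonglongrightarrow> shoot (g 0) g r"
      using shoot_tendsto[where W = "\<lambda>n s. v (k n) (delay (k n) s)", OF dcont L0 hL dtends \<alpha>tends r] fixpoint[OF r] by simp
  qed
  have "g 1 = 0"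
    using LIMSEQ_unique[OF tends[of 1]] end0 by simp
  with start_pos g limit_fixpoint show ?thesis
    by (rule that)
qed

section \<open>Positivity and regularity of the profile\<close>

theorem regular_solution_exists:
  obtains v p q where
    "\<And>r. r \<in> {0..1} \<Longrightarrow> (v has_real_derivative - p r) (at r within {0..1})"
    "\<And>r. r \<in> {0..1} \<Longrightarrow> (p has_real_derivative q r) (at r within {0..1})"
    "continuous_on {0..1} q"
    "\<And>r. r \<in> {0<..<1} \<Longrightarrow> ((\<lambda>s. p s ^ N) has_real_derivative real N * r ^ (N - 1) * h (v r)) (at r)"
    "p 0 = 0" "v 1 = 0"
    "\<And>r. r \<in> {0..<1} \<Longrightarrow> 0 < v r"
    "\<And>r. r \<in> {0..<1} \<Longrightarrow> 0 < q r"
proof -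
  obtain \<alpha> v where "0 < \<alpha>" and v: "continuous_on {0..1} v"
    and fixpoint: "\<And>r. r \<in> {0..1} \<Longrightarrow> v r = shoot \<alpha> v r" and "v 1 = 0"
    by (rule solution_exists) blast
  have pos: "0 < v r" if "r \<in> {0..<1}" for r
  proof -
    have "0 < (1 - r) * \<alpha>" using that \<open>0 < \<alpha>\<close> by simp
    also have "\<dots> \<le> v r"
      using shoot_ge_chord[OF v, of r \<alpha>] fixpoint that \<open>v 1 = 0\<close> by simp
    finally show ?thesis .
  qed
  have mean_pos: "0 < mean v t" if t: "t \<in> {0..1}" for t
  proof -
    have "mean v t \<noteq> 0"
    proof
      assume "mean v t = 0"
      then have "\<forall>x\<in>{0..1}. real N * x ^ (N - 1) * h (v (t * x)) = 0"
        unfolding mean_def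
        by (subst (asm) integral_eq_0_iff) (use mean_integrand_cont[OF v t] h_nonneg in auto)
      then have "real N * (1 / 2) ^ (N - 1) * h (v (t * (1 / 2))) = 0"
        by (rule bspec) simp
      \<comment> \<open>The midpoint has positive weight, and t/2 < 1 avoids the zero of v at the
        right end.\<close>
      moreover have "0 < h (v (t * (1 / 2)))"
        using t by (intro h_pos pos) auto
      ultimately show False using N_pos by simp
    qed
    then show ?thesis using mean_nonneg[OF v t] by simp
  qed
  define q where "q r = h (v r) / root N (mean v r) ^ (N - 1)" for r
  show ?thesis
  proof (rule that[of v "slope v" q])
    fix r :: real
    show "(v has_real_derivative - slope v r) (at r within {0..1})" if "r \<in> {0..1}"
      using shoot_has_derivative[OF v that, of \<alpha>]
      by (rule has_field_derivative_transform_within[where d = 1]) (use that fixpoint in auto)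
    show "(slope v has_real_derivative q r) (at r within {0..1})" if "r \<in> {0..1}"
      unfolding q_def by (intro slope_has_derivative v that mean_pos)
    show "((\<lambda>s. slope v s ^ N) has_real_derivative real N * r ^ (N - 1) * h (v r)) (at r)"
      if "r \<in> {0<..<1}"
      using slope_power_has_derivative[OF v, of r] that at_within_Icc_at[of 0 r 1] by simp
    \<comment> \<open>The right end is excluded because v vanishes there and h is known to be
      positive only at positive arguments.\<close>
    show "0 < q r" if "r \<in> {0..<1}"
      using that pos h_pos mean_pos N_pos by (simp add: q_def)
  next
    \<comment> \<open>The denominator of \<open>q\<close> stays nonzero up to the origin, so the
      second derivative is continuous there too.\<close>
    have "root N (mean v t) ^ (N - 1) \<noteq> 0" if "t \<in> {0..1}" for t
      using mean_pos[OF that] N_pos by simp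
    then show "continuous_on {0..1} q"
      unfolding q_def by (intro continuous_intros continuous_on_h continuous_on_mean1 v) auto
  qed (use pos \<open>v 1 = 0\<close> in \<open>auto simp: slope_def\<close>)
qed

end

section \<open>Shooting constants from the growth at zero and infinity\<close>

lemma shooting_bounds_exist:
  assumes N: "1 \<le> N" and cont: "continuous_on UNIV g" and pos: "\<And>s. 0 < s \<Longrightarrow> 0 < g s"
    and g0: "((\<lambda>s. g s / s ^ N) \<longlongrightarrow> 0) (at_right 0)"
    and ginf: "filterlim (\<lambda>s. g s / s ^ N) at_top at_top"
    and c: "0 < c"
  obtains a b where "radial_shooting N (\<lambda>s. c * g (max 0 s)) a b"
proof -
  \<comment> \<open>The limit of the quotient forces g to 0 from the right, so continuity gives
    \<open>g 0 = 0\<close>.\<close>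
  have "((\<lambda>s. g s / s ^ N * s ^ N) \<longlongrightarrow> 0 * 0 ^ N) (at_right 0)"
    by (intro tendsto_intros g0)
  moreover have "\<forall>\<^sub>F s in at_right 0. g s / s ^ N * s ^ N = g s"
    by (auto simp: eventually_at_filter)
  ultimately have "(g \<longlongrightarrow> 0) (at_right 0)"
    by (auto elim: Lim_transform_eventually)
  moreover have "(g \<longlongrightarrow> g 0) (at_right 0)"
    using cont by (simp add: continuous_on_eq_continuous_at isCont_def filterlim_at_split)
  ultimately have g_0: "g 0 = 0"
    using tendsto_unique[OF trivial_limit_at_right_real] by blast
  have "\<forall>\<^sub>F s in at_right 0. g s / s ^ N < 1 / c"
    using c by (intro order_tendstoD(2)[OF g0]) simp
  then obtain a0 where "0 < a0" and a0: "\<And>s. 0 < s \<Longrightarrow> s < a0 \<Longrightarrow> g s / s ^ N < 1 / c"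
    unfolding eventually_at_right_field by auto
  \<comment> \<open>Halving puts a itself strictly inside the range where \<open>c * g s\<close> is
    below \<open>s ^ N\<close>.\<close>
  define a where "a = a0 / 2"
  have a: "0 < a" "a < a0" using \<open>0 < a0\<close> by (auto simp: a_def)
  \<comment> \<open>The constant 16 matches 8 b: for s at least b/2, 16 s is at least 8 b.\<close>
  have "\<forall>\<^sub>F s in at_top. 16 ^ N / c \<le> g s / s ^ N"
    using ginf unfolding filterlim_at_top by blast
  then obtain S where S: "\<And>s. S \<le> s \<Longrightarrow> 16 ^ N / c \<le> g s / s ^ N"
    unfolding eventually_at_top_linorder by blast
  \<comment> \<open>The term \<open>2 * S\<close> brings b/2 beyond S; the maximum with a secures
    the order of the two starts.\<close>
  define b where "b = max (2 * S) a"
  \<comment> \<open>The sign of g is controlled only for positive arguments; truncation extends the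
    source by zero to negative ones.\<close>
  have "radial_shooting N (\<lambda>s. c * g (max 0 s)) a b"
  proof
    show "continuous_on UNIV (\<lambda>s. c * g (max 0 s))"
      by (intro continuous_intros continuous_on_compose2[OF cont]) auto
    show "0 \<le> c * g (max 0 s)" for s
      using pos[of s] g_0 c by (cases "0 < s") (auto simp: max_def less_imp_le)
    show "0 < c * g (max 0 s)" if "0 < s" for s
      using pos[OF that] that c by simp
    show "c * g (max 0 s) \<le> a ^ N" if "s \<le> a" for s
    proof (cases "0 < s")
      case True
      then have "c * g s \<le> s ^ N"
        using a0[of s] a that c by (simp add: field_simps)
      also have "\<dots> \<le> a ^ N"
        using True that by (intro power_mono) auto
      finally show ?thesis using True by simp
    qed (use a g_0 in \<open>simp add: max_def\<close>)
    show "(8 * b) ^ N \<le> c * g (max 0 s)" if "b / 2 \<le> s" for s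
    proof -
      have "S \<le> s" "a \<le> b" using that by (auto simp: b_def)
      then have "0 < s" using that a by simp
      have "(8 * b) ^ N \<le> (16 * s) ^ N"
        using that a \<open>a \<le> b\<close> by (intro power_mono) auto
      also have "\<dots> \<le> c * g s"
        using S[OF \<open>S \<le> s\<close>] \<open>0 < s\<close> c by (simp add: field_simps)
      finally show ?thesis using \<open>0 < s\<close> by simp
    qed
  qed (use N a in \<open>auto simp: b_def\<close>)
  then show ?thesis by (rule that)
qed

text \<open>As v is positive inside, the truncation disappears from the equation. Positivity of q
  makes p = -v' strictly increasing, whence strict convexity of -v.\<close>

lemma positive_radial_solution:
  assumes "1 \<le> N" "continuous_on UNIV g" "\<And>s. 0 < s \<Longrightarrow> 0 < g s"
    and "((\<lambda>s. g s / s ^ N) \<longlongrightarrow> 0) (at_right 0)"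
    and "filterlim (\<lambda>s. g s / s ^ N) at_top at_top"
    and "0 < c"
  obtains v p q where
    "\<And>r. r \<in> {0..1} \<Longrightarrow> (v has_real_derivative - p r) (at r within {0..1})"
    "\<And>r. r \<in> {0..1} \<Longrightarrow> (p has_real_derivative q r) (at r within {0..1})"
    "continuous_on {0..1} q"
    "\<And>r. r \<in> {0<..<1} \<Longrightarrow> ((\<lambda>s. p s ^ N) has_real_derivative c * real N * r ^ (N - 1) * g (v r)) (at r)"
    "p 0 = 0" "v 1 = 0"
    "\<And>r. r \<in> {0<..<1} \<Longrightarrow> 0 < v r"
    "strictly_convex_on {0<..<1} (\<lambda>r. - v r)"
proof -
  obtain a b where "radial_shooting N (\<lambda>s. c * g (max 0 s)) a b"
    using shooting_bounds_exist[OF assms] .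
  then interpret radial_shooting N "\<lambda>s. c * g (max 0 s)" a b .
  have interior: "at r within {0..1} = at r" if "r \<in> {0<..<1}" for r :: real
    using that by (simp add: at_within_Icc_at)
  show ?thesis
  proof (rule regular_solution_exists)
    fix v p q
    assume v: "\<And>r. r \<in> {0..1} \<Longrightarrow> (v has_real_derivative - p r) (at r within {0..1})"
      and p: "\<And>r. r \<in> {0..1} \<Longrightarrow> (p has_real_derivative q r) (at r within {0..1})"
      and q: "continuous_on {0..1} q"
      and ode: "\<And>r. r \<in> {0<..<1} \<Longrightarrow>
      ((\<lambda>s. p s ^ N) has_real_derivative real N * r ^ (N - 1) * (c * g (max 0 (v r)))) (at r)"
      and bc: "p 0 = 0" "v 1 = 0"
      and v_pos: "\<And>r. r \<in> {0..<1} \<Longrightarrow> 0 < v r" and q_pos: "\<And>r. r \<in> {0..<1} \<Longrightarrow> 0 < q r"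
    show thesis
    proof (rule that[OF v p q _ bc])
      show "((\<lambda>s. p s ^ N) has_real_derivative c * real N * r ^ (N - 1) * g (v r)) (at r)"
        if "r \<in> {0<..<1}" for r
        using ode[OF that] v_pos[of r] that by (simp add: mult_ac)
      show "strictly_convex_on {0<..<1} (\<lambda>r. - v r)"
      proof (rule strictly_convex_on_if_deriv_strict_mono[where g' = p])
        show "((\<lambda>r. - v r) has_real_derivative p r) (at r)" if "r \<in> {0<..<1}" for r
          using DERIV_minus[OF v[of r]] interior[OF that] that by simp
        fix x y :: real assume xy: "x \<in> {0<..<1}" "y \<in> {0<..<1}" "x < y"
        show "p x < p y"
        proof (rule DERIV_pos_imp_increasing[OF xy(3)])
          fix t assume "x \<le> t" "t \<le> y"
          with xy show "\<exists>D. (p has_real_derivative D) (at t) \<and> 0 < D"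
            using p[of t] q_pos[of t] interior[of t] by (intro exI[of _ "q t"]) simp
        qed
      qed simp
    qed (use v_pos in auto)
  qed
qed

section \<open>The negative convex and the positive concave solution\<close>

theorem theorem4p6:
  fixes N :: nat and f :: "real \<Rightarrow> real" and lam :: real
  assumes "N \<ge> 1"
    and "cond_f1 N f"
    and "((\<lambda>s. f s / s ^ N) \<longlongrightarrow> 0) (at 0)"
    and "filterlim (\<lambda>s. f s / s ^ N) at_top at_infinity"
    and "lam > 0"
  shows "\<exists>up um. MO_solution N f lam up \<and> MO_solution N f lam um \<and>
           (\<forall>r\<in>{0<..<1}. up r > 0) \<and> strictly_concave_on {0<..<1} up \<and>
           (\<forall>r\<in>{0<..<1}. um r < 0) \<and> strictly_convex_on {0<..<1} um"
proof -
  have cont: "continuous_on UNIV f" and sign: "\<And>s. s \<noteq> 0 \<Longrightarrow> 0 < f s * s ^ N"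
    using assms(2) by (auto simp: cond_f1_def)
  have c: "0 < lam ^ N" using assms(5) by simp
  have inf: "filterlim (\<lambda>s. f s / s ^ N) at_top at_top" "filterlim (\<lambda>s. f s / s ^ N) at_top at_bot"
    by (rule filterlim_mono[OF assms(4) order_refl]; simp add: at_infinity_eq_at_top_bot)+
  have zero: "((\<lambda>s. f s / s ^ N) \<longlongrightarrow> 0) (at_right 0)" "((\<lambda>s. f s / s ^ N) \<longlongrightarrow> 0) (at_left 0)"
    using assms(3) by (simp_all add: filterlim_at_split)

  \<comment> \<open>For u = -v the source \<open>f (- u)\<close> is \<open>f v\<close> and u' is p,
    so the profile for f itself yields the negative solution.\<close>
  obtain v p q where v: "\<And>r. r \<in> {0..1} \<Longrightarrow> (v has_real_derivative - p r) (at r within {0..1})"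
    and p: "\<And>r. r \<in> {0..1} \<Longrightarrow> (p has_real_derivative q r) (at r within {0..1})"
    and q: "continuous_on {0..1} q"
    and ode: "\<And>r. r \<in> {0<..<1} \<Longrightarrow>
      ((\<lambda>s. p s ^ N) has_real_derivative lam ^ N * real N * r ^ (N - 1) * f (v r)) (at r)"
    and bc: "p 0 = 0" "v 1 = 0" and pos: "\<And>r. r \<in> {0<..<1} \<Longrightarrow> 0 < v r"
    and convex: "strictly_convex_on {0<..<1} (\<lambda>r. - v r)"
  proof (rule positive_radial_solution[OF assms(1) cont _ zero(1) inf(1) c])
    show "0 < f s" if "0 < s" for s
      using sign[of s] that by (simp add: zero_less_mult_iff)
  qed blast
  have um: "MO_solution N f lam (\<lambda>r. - v r)"
    unfolding MO_solution_def
  proof (rule exI[of _ p], rule exI[of _ q], intro conjI ballI)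
    show "((\<lambda>r. - v r) has_real_derivative p r) (at r within {0..1})" if "r \<in> {0..1}" for r
      using DERIV_minus[OF v[OF that]] by simp
    show "((\<lambda>s. p s ^ N) has_real_derivative lam ^ N * real N * r ^ (N - 1) * f (- (- v r))) (at r)"
      if "r \<in> {0<..<1}" for r
      using ode[OF that] by simp
  qed (use p q bc in simp_all)

  \<comment> \<open>For u = w the derivative is -p', whose N-th power carries the sign (-1)^N.
    Absorbing it into g makes g positive on the positive axis and its quotient by
    \<open>s ^ N\<close> the reflected quotient of f.\<close>
  define g where "g s = (- 1) ^ N * f (- s)" for s
  have g_quot: "g s / s ^ N = f (- s) / (- s) ^ N" for s
    by (cases "even N") (simp_all add: g_def)
  obtain w p' q' where w: "\<And>r. r \<in> {0..1} \<Longrightarrow> (w has_real_derivative - p' r) (at r within {0..1})"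
    and p': "\<And>r. r \<in> {0..1} \<Longrightarrow> (p' has_real_derivative q' r) (at r within {0..1})"
    and q': "continuous_on {0..1} q'"
    and ode': "\<And>r. r \<in> {0<..<1} \<Longrightarrow>
      ((\<lambda>s. p' s ^ N) has_real_derivative lam ^ N * real N * r ^ (N - 1) * g (w r)) (at r)"
    and bc': "p' 0 = 0" "w 1 = 0" and pos': "\<And>r. r \<in> {0<..<1} \<Longrightarrow> 0 < w r"
    and convex': "strictly_convex_on {0<..<1} (\<lambda>r. - w r)"
  proof (rule positive_radial_solution[OF assms(1) _ _ _ _ c])
    show "continuous_on UNIV g"
      unfolding g_def by (intro continuous_intros continuous_on_compose2[OF cont]) auto
    show "0 < g s" if "0 < s" for s
      using sign[of "- s"] that by (cases "even N") (auto simp: g_def zero_less_mult_iff mult_less_0_iff)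
    show "((\<lambda>s. g s / s ^ N) \<longlongrightarrow> 0) (at_right 0)"
      unfolding g_quot using zero(2) by (simp add: filterlim_at_left_to_right)
    show "filterlim (\<lambda>s. g s / s ^ N) at_top at_top"
      unfolding g_quot using inf(2) by (simp add: filterlim_at_bot_mirror)
  qed blast
  have up: "MO_solution N f lam w"
    unfolding MO_solution_def
  proof (rule exI[of _ "\<lambda>r. - p' r"], rule exI[of _ "\<lambda>r. - q' r"], intro conjI ballI)
    fix r :: real assume r: "r \<in> {0<..<1}"
    \<comment> \<open>The sign multiplied in here cancels the one in the definition of
      \<open>g\<close>.\<close>
    have "((\<lambda>s. (- 1) ^ N * p' s ^ N) has_real_derivative
        (- 1) ^ N * (lam ^ N * real N * r ^ (N - 1) * g (w r))) (at r)"
      by (rule DERIV_cmult[OF ode'[OF r]])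
    moreover have "(- 1) ^ N * (lam ^ N * real N * r ^ (N - 1) * g (w r))
        = lam ^ N * real N * r ^ (N - 1) * f (- w r)"
      by (cases "even N") (simp_all add: g_def)
    ultimately show "((\<lambda>s. (- p' s) ^ N) has_real_derivative
        lam ^ N * real N * r ^ (N - 1) * f (- w r)) (at r)"
      by (simp only: power_minus[of "p' _"])
  qed (use w p' q' bc' in \<open>auto intro!: DERIV_minus continuous_intros\<close>)
  show ?thesis
    using up um pos pos' convex convex'
    by (intro exI[of _ w] exI[of _ "\<lambda>r. - v r"]) (auto simp: strictly_concave_on_def)
qed

end
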